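(* Let $\mathcal{H}$ be a real Hilbert space. Let $f:\mathcal{H}\to\mathbb{R}$ and $g:\mathcal{H}\to\mathbb{R}\cup\{+\infty\}$ be proper, lower semi-continuous and convex, with $f$ Fréchet differentiable with $\beta$-Lipschitz continuous gradient $\nabla f$, $\mathrm{dom}\,f\cap\mathrm{dom}\,g\neq\emptyset$ and $\mathrm{Arg}\min(f+g)\neq\emptyset$. Let $\mathcal{Q}:\mathcal{H}\to\mathcal{H}$ be linear, bounded, self-adjoint, with closed range, and degenerate, i.e. positive semi-definite with $\ker\mathcal{Q}\setminus\{0\}\neq\emptyset$. Assume $\mathrm{ran}\,\nabla f\subseteq\mathrm{ran}\,\mathcal{Q}$ and $\mathrm{ran}(\partial g+\mathcal{Q})\supseteq\mathrm{ran}(\mathcal{Q}-\nabla f)$. Let $\nu\in\,]0,+\infty[$ be a constant with $\|\mathcal{Q}x\|\ge\nu\|x\|$ for all $x\in(\ker\mathcal{Q})^\perp=\mathrm{ran}\,\mathcal{Q}$. Let $x^\star\in\mathrm{Arg}\min(f+g)$, $x^0\in\mathcal{H}$, and let $\{x^k\}_{k\in\mathbb{N}}$ be generated by $x^{k+1}:=(\partial g+\mathcal{Q})^{-1}(\mathcal{Q}-\nabla f)x^k$. If $\nu\ge\beta$, then the objective value $(f+g)(x^k)$ converges to $(f+g)(x^\star)$ with the non-ergodic rate $\mathcal{O}(1/k)$, i.e. for every $k\ge1$, $$(f+g)(x^k)-(f+g)(x^\star)\le\frac{1}{2k}\|x^0-x^\star\|_{\mathcal{Q}}^2.$$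
   Context: $\|x\|_{\mathcal{Q}}^2:=\langle\mathcal{Q}x|x\rangle$ (a seminorm when $\mathcal{Q}$ is degenerate). $\mathrm{Arg}\min$ denotes the set of minimizers and $\partial g$ the convex subdifferential. The iteration means $0\in\partial g(x^{k+1})+\nabla f(x^k)+\mathcal{Q}(x^{k+1}-x^k)$. *)

theory Defs
  imports "HOL-Analysis.Analysis"
begin

definition eff_dom :: "('a \<Rightarrow> ereal) \<Rightarrow> 'a set" where
  "eff_dom h = {x. h x < \<infinity>}"

definition proper_fun :: "('a \<Rightarrow> ereal) \<Rightarrow> bool" where
  "proper_fun h \<longleftrightarrow> (\<forall>x. h x \<noteq> -\<infinity>) \<and> eff_dom h \<noteq> {}"

definition lsc :: "('a::topological_space \<Rightarrow> ereal) \<Rightarrow> bool" where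
  "lsc h \<longleftrightarrow> (\<forall>x. h x \<le> Liminf (nhds x) h)"

(* Only meant for functions that never take the value -\<infinity>, so that the sum on the
   right is never of the form \<infinity> - \<infinity>; on real-valued functions it is convex_on UNIV. *)
definition convex_fun :: "('a::real_vector \<Rightarrow> ereal) \<Rightarrow> bool" where
  "convex_fun h \<longleftrightarrow> (\<forall>x y. \<forall>u>0. \<forall>v>0. u + v = 1 \<longrightarrow>
     h (u *\<^sub>R x + v *\<^sub>R y) \<le> ereal u * h x + ereal v * h y)"

lemma convex_fun_ereal_iff: "convex_fun (\<lambda>x. ereal (f x)) \<longleftrightarrow> convex_on UNIV f"
proof
  assume L: "convex_fun (\<lambda>x. ereal (f x))"
  show "convex_on UNIV f"
  proof (rule convex_onI)
    fix t :: real and x y :: 'a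
    assume "0 < t" "t < 1"
    with L[unfolded convex_fun_def, rule_format, of "1 - t" t x y]
    show "f ((1 - t) *\<^sub>R x + t *\<^sub>R y) \<le> (1 - t) * f x + t * f y" by simp
  qed simp
next
  assume "convex_on UNIV f"
  then show "convex_fun (\<lambda>x. ereal (f x))"
    by (auto simp: convex_fun_def convex_on_def)
qed

(* At a point where h is infinite this is empty as soon as h is proper. *)
definition subdiff :: "('a::real_inner \<Rightarrow> ereal) \<Rightarrow> 'a \<Rightarrow> 'a set" where
  "subdiff h x = {u. \<forall>y. h x + ereal (u \<bullet> (y - x)) \<le> h y}"

definition Argmin :: "('a \<Rightarrow> ereal) \<Rightarrow> 'a set" where
  "Argmin h = {x. is_arg_min h (\<lambda>_. True) x}"

definition kernel :: "('a \<Rightarrow> 'b::zero) \<Rightarrow> 'a set" where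
  "kernel Q = {x. Q x = 0}"

definition self_adjoint :: "('a::real_inner \<Rightarrow> 'a) \<Rightarrow> bool" where
  "self_adjoint Q \<longleftrightarrow> (\<forall>x y. Q x \<bullet> y = x \<bullet> Q y)"

definition degenerate :: "('a::real_inner \<Rightarrow> 'a) \<Rightarrow> bool" where
  "degenerate Q \<longleftrightarrow> (\<forall>x. 0 \<le> Q x \<bullet> x) \<and> kernel Q - {0} \<noteq> {}"

definition seminorm_sq :: "('a::real_inner \<Rightarrow> 'a) \<Rightarrow> 'a \<Rightarrow> real" where
  "seminorm_sq Q x = Q x \<bullet> x"

end

theory Submission
  imports Defs
begin

text \<open>
  Since \<open>gradf\<close> takes values in \<open>range Q\<close>, the function \<open>f\<close> is constant along \<open>kernel Q\<close>, so the
  quadratic term of the descent lemma only sees the \<open>range Q\<close>-component \<open>p\<close> of a displacement \<open>d\<close>.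
  On \<open>range Q\<close> the lower bound \<open>\<nu> * norm p \<le> norm (Q p)\<close> upgrades to \<open>\<nu> * (norm p)\<^sup>2 \<le> Q p \<bullet> p\<close>, and
  \<open>\<beta> \<le> \<nu>\<close> turns the quadratic term into \<open>seminorm_sq Q d / 2\<close>. The step is therefore a proximal
  gradient step with step size one in the \<open>Q\<close>-geometry, and the classical argument applies:
  \<open>F x\<^sup>+ - F y \<le> (seminorm_sq Q (x - y) - seminorm_sq Q (x\<^sup>+ - y)) / 2\<close> for all \<open>y\<close>, which gives
  monotonicity for \<open>y = x\<close> and telescopes for \<open>y = xstar\<close>.
\<close>

section \<open>Orthogonal projection onto a closed subspace of a Hilbert space\<close>

text \<open>A minimizing sequence for the distance to \<open>S\<close> is Cauchy, its limit
  \<open>p\<close> is a nearest point, and minimality of \<open>p\<close> along the lines through it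
  in \<open>S\<close> forces orthogonality.\<close>

lemma orthogonal_projection_exists:
  fixes S :: "'a::{real_inner, complete_space} set"
  assumes S: "subspace S" "closed S"
  obtains p where "p \<in> S" "\<And>z. z \<in> S \<Longrightarrow> (x - p) \<bullet> z = 0"
proof -
  define D where "D = (INF y\<in>S. (norm (x - y))\<^sup>2)"
  have bdd: "bdd_below ((\<lambda>y. (norm (x - y))\<^sup>2) ` S)"
    by (rule bdd_belowI[of _ 0]) auto
  have D_le: "D \<le> (norm (x - y))\<^sup>2" if "y \<in> S" for y
    unfolding D_def using bdd that by (rule cINF_lower)
  have "S \<noteq> {}"
    using subspace_0[OF S(1)] by auto
  then have "\<exists>y\<in>S. (norm (x - y))\<^sup>2 < D + inverse (real (Suc n))" for n
    using bdd cINF_less_iff[of S "\<lambda>y. (norm (x - y))\<^sup>2" "D + inverse (real (Suc n))"]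
    by (simp add: D_def)
  then obtain y where yS: "y n \<in> S" and y: "(norm (x - y n))\<^sup>2 < D + inverse (real (Suc n))" for n
    by metis
  \<comment> \<open>Parallelogram law: the midpoint lies in \<open>S\<close>, so its squared
    distance to \<open>x\<close> is at least \<open>D\<close>.\<close>
  have par: "(norm (y m - y n))\<^sup>2 \<le> 2 * inverse (real (Suc m)) + 2 * inverse (real (Suc n))" for m n
  proof -
    have "(1/2) *\<^sub>R (y m + y n) \<in> S"
      using S(1) yS by (intro subspace_scale subspace_add)
    from D_le[OF this] have "D \<le> (norm (x - (1/2) *\<^sub>R (y m + y n)))\<^sup>2" .
    moreover have "(norm (y m - y n))\<^sup>2 =
        2 * (norm (x - y m))\<^sup>2 + 2 * (norm (x - y n))\<^sup>2 - 4 * (norm (x - (1/2) *\<^sub>R (y m + y n)))\<^sup>2"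
      by (simp add: power2_norm_eq_inner inner_diff_left inner_diff_right inner_add_left
          inner_add_right inner_commute algebra_simps)
    ultimately show ?thesis
      using y[of m] y[of n] by linarith
  qed
  have "Cauchy y"
  proof (rule CauchyI)
    fix e :: real
    assume "0 < e"
    then obtain N where N: "inverse (real (Suc N)) < e\<^sup>2 / 4"
      using reals_Archimedean[of "e\<^sup>2 / 4"] by auto
    have "norm (y m - y n) < e" if "N \<le> m" "N \<le> n" for m n
    proof -
      have "inverse (real (Suc m)) \<le> inverse (real (Suc N))"
        "inverse (real (Suc n)) \<le> inverse (real (Suc N))"
        using that by (auto intro!: le_imp_inverse_le)
      then have "(norm (y m - y n))\<^sup>2 < e\<^sup>2"
        using par[of m n] N by linarith
      then show ?thesis
        using \<open>0 < e\<close> by (meson less_imp_le power2_less_imp_less)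
    qed
    then show "\<exists>M. \<forall>m\<ge>M. \<forall>n\<ge>M. norm (y m - y n) < e"
      by blast
  qed
  then obtain p where p: "y \<longlonglongrightarrow> p"
    by (auto simp: Cauchy_convergent_iff convergent_def)
  have pS: "p \<in> S"
    using S(2) yS p by (rule closed_sequentially)
  have "(norm (x - p))\<^sup>2 \<le> D + 0"
  proof (rule LIMSEQ_le)
    show "(\<lambda>n. (norm (x - y n))\<^sup>2) \<longlonglongrightarrow> (norm (x - p))\<^sup>2"
      by (intro tendsto_intros p)
    show "(\<lambda>n. D + inverse (real (Suc n))) \<longlonglongrightarrow> D + 0"
      by (intro tendsto_add tendsto_const LIMSEQ_inverse_real_of_nat)
    show "\<exists>N. \<forall>n\<ge>N. (norm (x - y n))\<^sup>2 \<le> D + inverse (real (Suc n))"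
      using y less_imp_le by blast
  qed
  then have p_min: "(norm (x - p))\<^sup>2 \<le> D"
    by simp
  have "(x - p) \<bullet> z = 0" if "z \<in> S" for z
  proof (cases "z = 0")
    case False
    \<comment> \<open>This \<open>t\<close> minimizes the squared norm of
      \<open>x - p - t z\<close>; as \<open>p\<close> is already nearest, it must vanish.\<close>
    define t where "t = (x - p) \<bullet> z / (z \<bullet> z)"
    have tz: "t * (z \<bullet> z) = (x - p) \<bullet> z"
      using False by (simp add: t_def)
    have "p + t *\<^sub>R z \<in> S"
      using S(1) pS that by (intro subspace_scale subspace_add)
    from order_trans[OF p_min D_le[OF this]]
    have "(norm (x - p))\<^sup>2 \<le> (norm ((x - p) - t *\<^sub>R z))\<^sup>2"
      by (simp add: algebra_simps)
    also have "\<dots> = (norm (x - p))\<^sup>2 - 2 * t * ((x - p) \<bullet> z) + t * (t * (z \<bullet> z))"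
      unfolding power2_norm_eq_inner
      by (simp add: inner_diff_left inner_diff_right inner_commute algebra_simps)
    finally have "t * (t * (z \<bullet> z)) \<le> 0"
      unfolding tz by simp
    then have "t\<^sup>2 * (z \<bullet> z) \<le> 0"
      by (simp add: power2_eq_square mult.assoc)
    moreover have "0 < z \<bullet> z"
      using False by simp
    ultimately have "t = 0"
      by (smt (verit) mult_pos_pos zero_less_power2)
    then show ?thesis
      using tz by simp
  qed simp
  with pS show thesis
    by (rule that)
qed

section \<open>Positive semi-definite self-adjoint operators with closed range\<close>

text \<open>Discriminant argument for the form at \<open>a x - b y\<close>. The form may be
  degenerate, so a null vector \<open>y\<close> is treated separately.\<close>

lemma psd_Cauchy_Schwarz:
  fixes Q :: "'a::real_inner \<Rightarrow> 'a"
  assumes lin: "linear Q" and sa: "self_adjoint Q" and psd: "\<And>x. 0 \<le> Q x \<bullet> x"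
  shows "(Q x \<bullet> y)\<^sup>2 \<le> (Q x \<bullet> x) * (Q y \<bullet> y)"
proof -
  have sym: "Q y \<bullet> x = Q x \<bullet> y"
    using sa by (simp add: self_adjoint_def inner_commute)
  have quad: "0 \<le> a\<^sup>2 * (Q x \<bullet> x) - 2 * a * b * (Q x \<bullet> y) + b\<^sup>2 * (Q y \<bullet> y)" for a b
    using psd[of "a *\<^sub>R x - b *\<^sub>R y"]
    by (simp add: linear_diff[OF lin] linear_scale[OF lin] inner_diff_left inner_diff_right sym
        power2_eq_square algebra_simps)
  show ?thesis
  proof (cases "Q y \<bullet> y = 0")
    case True
    have "Q x \<bullet> y = 0"
    proof (rule ccontr)
      assume "Q x \<bullet> y \<noteq> 0"
      \<comment> \<open>With \<open>Q y \<bullet> y = 0\<close> the expression is affine in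
        \<open>b\<close>, and this \<open>b\<close> makes it equal to -1.\<close>
      with quad[of 1 "(Q x \<bullet> x + 1) / (2 * (Q x \<bullet> y))"] True show False
        by simp
    qed
    then show ?thesis
      using True by simp
  next
    case False
    then have pos: "0 < Q y \<bullet> y"
      using psd[of y] by simp
    have "0 \<le> (Q y \<bullet> y) * ((Q x \<bullet> x) * (Q y \<bullet> y) - (Q x \<bullet> y)\<^sup>2)"
      using quad[of "Q y \<bullet> y" "Q x \<bullet> y"] by (simp add: power2_eq_square algebra_simps)
    then show ?thesis
      using pos by (simp add: zero_le_mult_iff)
  qed
qed

text \<open>Project \<open>d\<close> onto the closed range. By self-adjointness the residual, being
  orthogonal to the range, lies in the kernel.\<close>

lemma range_self_adjoint_decomposition:
  fixes Q :: "'a::{real_inner, complete_space} \<Rightarrow> 'a"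
  assumes lin: "linear Q" and sa: "self_adjoint Q" and cl: "closed (range Q)"
  obtains w where "Q (d - Q w) = 0" "\<And>v. (d - Q w) \<bullet> Q v = 0"
proof -
  have "subspace (range Q)"
    by (rule linear_subspace_image[OF lin subspace_UNIV])
  then obtain p where p: "p \<in> range Q" "\<And>z. z \<in> range Q \<Longrightarrow> (d - p) \<bullet> z = 0"
    using cl orthogonal_projection_exists by blast
  then obtain w where w: "p = Q w"
    by blast
  have orth: "(d - Q w) \<bullet> Q v = 0" for v
    using p(2) w by blast
  have "Q (d - Q w) \<bullet> Q (d - Q w) = 0"
    using sa orth by (simp add: self_adjoint_def)
  then show thesis
    using that orth by simp
qed

text \<open>Makes the lower bound on \<open>Q\<close>, stated on the orthogonal complement of the
  kernel, available for vectors of the range.\<close>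

lemma self_adjoint_range_orthogonal_kernel:
  assumes "self_adjoint Q"
  shows "Q w \<in> orthogonal_comp (kernel Q)"
  using assms by (auto simp: orthogonal_comp_def orthogonal_def kernel_def)
    (metis inner_zero_left self_adjoint_def)

text \<open>
  Write \<open>p = Q v\<close> with \<open>v \<in> range Q\<close>. The Cauchy-Schwarz inequality of the form \<open>Q\<close> gives
  \<open>(norm p)^4 = (Q p \<bullet> v)\<^sup>2 \<le> (Q p \<bullet> p) * (p \<bullet> v)\<close>, and \<open>p \<bullet> v \<le> (norm p)\<^sup>2 / \<nu>\<close>. This avoids
  square roots of operators.
\<close>
lemma psd_coercive_on_range:
  fixes Q :: "'a::{real_inner, complete_space} \<Rightarrow> 'a"
  assumes lin: "linear Q" and sa: "self_adjoint Q" and cl: "closed (range Q)"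
    and psd: "\<And>x. 0 \<le> Q x \<bullet> x" and \<nu>: "0 < \<nu>"
    and bound: "\<forall>z \<in> orthogonal_comp (kernel Q). \<nu> * norm z \<le> norm (Q z)"
    and p: "p \<in> range Q"
  shows "\<nu> * (norm p)\<^sup>2 \<le> Q p \<bullet> p"
proof (cases "p = 0")
  case False
  from p obtain w where w: "p = Q w"
    by blast
  obtain w' where w': "Q (w - Q w') = 0"
    using range_self_adjoint_decomposition[OF lin sa cl] by blast
  define v where "v = Q w'"
  have Qv: "Q v = p"
    using w' by (simp add: v_def w linear_diff[OF lin])
  have "\<nu> * norm v \<le> norm p"
    using bound self_adjoint_range_orthogonal_kernel[OF sa, of w'] Qv by (auto simp: v_def)
  have "\<nu> * (p \<bullet> v) \<le> \<nu> * (norm p * norm v)"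
    using \<nu> by (intro mult_left_mono norm_cauchy_schwarz) auto
  also have "\<dots> = norm p * (\<nu> * norm v)"
    by simp
  also have "\<dots> \<le> norm p * norm p"
    using \<open>\<nu> * norm v \<le> norm p\<close> by (intro mult_left_mono) auto
  finally have pv: "\<nu> * (p \<bullet> v) \<le> (norm p)\<^sup>2"
    by (simp add: power2_eq_square)
  have "Q p \<bullet> v = (norm p)\<^sup>2"
    using sa Qv by (simp add: self_adjoint_def power2_norm_eq_inner)
  then have "((norm p)\<^sup>2)\<^sup>2 \<le> (Q p \<bullet> p) * (p \<bullet> v)"
    using psd_Cauchy_Schwarz[OF lin sa psd, of p v] Qv by simp
  then have "\<nu> * ((norm p)\<^sup>2)\<^sup>2 \<le> (Q p \<bullet> p) * (\<nu> * (p \<bullet> v))"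
    using \<nu> by (simp add: mult.left_commute)
  also have "\<dots> \<le> (Q p \<bullet> p) * (norm p)\<^sup>2"
    using pv psd by (intro mult_left_mono) auto
  finally have "(\<nu> * (norm p)\<^sup>2) * (norm p)\<^sup>2 \<le> (Q p \<bullet> p) * (norm p)\<^sup>2"
    by (simp add: power2_eq_square mult.assoc)
  then show ?thesis
    using False by simp
qed simp

section \<open>First-order inequalities for differentiable functions, by restriction to
  lines\<close>

lemma GDERIV_along_line:
  assumes "GDERIV f (x + t *\<^sub>R d) :> D"
  shows "((\<lambda>t. f (x + t *\<^sub>R d)) has_real_derivative D \<bullet> d) (at t)"
proof -
  have "((\<lambda>t. x + t *\<^sub>R d) has_derivative (\<lambda>h. h *\<^sub>R d)) (at t)"
    by (auto intro!: derivative_eq_intros)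
  from has_derivative_compose[OF this assms[unfolded gderiv_def]]
  show ?thesis
    by (simp add: has_field_derivative_def inner_commute mult_commute_abs)
qed

lemma convex_on_above_gradient:
  assumes conv: "convex_on UNIV f" and grad: "GDERIV f x :> D"
  shows "f x + D \<bullet> (y - x) \<le> f y"
proof -
  define \<phi> where "\<phi> t = f (x + t *\<^sub>R (y - x))" for t
  have "convex_on UNIV \<phi>"
  proof (rule convex_onI)
    fix t a b :: real
    assume t: "0 < t" "t < 1"
    have "x + ((1 - t) * a + t * b) *\<^sub>R (y - x)
        = (1 - t) *\<^sub>R (x + a *\<^sub>R (y - x)) + t *\<^sub>R (x + b *\<^sub>R (y - x))"
      by (simp add: algebra_simps)
    then show "\<phi> ((1 - t) *\<^sub>R a + t *\<^sub>R b) \<le> (1 - t) * \<phi> a + t * \<phi> b"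
      using convex_onD[OF conv, of t] t by (simp add: \<phi>_def)
  qed simp
  moreover have "(\<phi> has_real_derivative D \<bullet> (y - x)) (at 0)"
    unfolding \<phi>_def using grad by (intro GDERIV_along_line) simp
  ultimately have "\<phi> 1 - \<phi> 0 \<ge> (D \<bullet> (y - x)) * (1 - 0)"
    by (intro convex_on_imp_above_tangent[where A = UNIV]) auto
  then show ?thesis
    by (simp add: \<phi>_def)
qed

text \<open>The gap \<open>\<phi>\<close> between \<open>f\<close> on the segment and its quadratic
  majorant is nonincreasing, because the Lipschitz bound on the gradient makes its derivative
  nonpositive.\<close>

lemma descent_lemma:
  assumes grad: "\<And>z. GDERIV f z :> gradf z" and lip: "\<beta>-lipschitz_on UNIV gradf"
  shows "f (x + d) \<le> f x + gradf x \<bullet> d + \<beta> / 2 * (norm d)\<^sup>2"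
proof -
  define \<phi> where "\<phi> t = f (x + t *\<^sub>R d) - t * (gradf x \<bullet> d) - \<beta> / 2 * t\<^sup>2 * (norm d)\<^sup>2" for t
  have "\<phi> 0 \<ge> \<phi> 1"
  proof (rule DERIV_nonpos_imp_nonincreasing[where f = \<phi>])
    fix t :: real
    assume t: "0 \<le> t"
    have "(\<phi> has_real_derivative
        gradf (x + t *\<^sub>R d) \<bullet> d - gradf x \<bullet> d - \<beta> * t * (norm d)\<^sup>2) (at t)"
      unfolding \<phi>_def by (auto intro!: derivative_eq_intros GDERIV_along_line grad)
    moreover have "(gradf (x + t *\<^sub>R d) - gradf x) \<bullet> d \<le> (\<beta> * (t * norm d)) * norm d"
    proof (rule order_trans[OF norm_cauchy_schwarz mult_right_mono])
      show "norm (gradf (x + t *\<^sub>R d) - gradf x) \<le> \<beta> * (t * norm d)"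
        using lipschitz_onD[OF lip, of "x + t *\<^sub>R d" x] t by (simp add: dist_norm)
    qed simp
    ultimately show "\<exists>s. (\<phi> has_real_derivative s) (at t) \<and> s \<le> 0"
      by (intro exI conjI) (auto simp: inner_diff_left power2_eq_square mult.assoc)
  qed simp
  then show ?thesis
    by (simp add: \<phi>_def)
qed

lemma constant_along_gradient_orthogonal:
  assumes grad: "\<And>z. GDERIV f z :> gradf z" and orth: "\<And>z. gradf z \<bullet> r = 0"
  shows "f (x + r) = f x"
proof -
  have "((\<lambda>t. f (x + t *\<^sub>R r)) has_real_derivative 0) (at t)" for t
    using GDERIV_along_line[OF grad, where x = x and t = t and d = r] by (simp add: orth)
  then have "f (x + 1 *\<^sub>R r) = f (x + 0 *\<^sub>R r)"
    by (intro DERIV_isconst_all[of "\<lambda>t. f (x + t *\<^sub>R r)"]) blast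
  then show ?thesis
    by simp
qed

lemma descent_lemma_seminorm:
  fixes Q :: "'a::{real_inner, complete_space} \<Rightarrow> 'a"
  assumes lin: "linear Q" and sa: "self_adjoint Q" and cl: "closed (range Q)"
    and psd: "\<And>x. 0 \<le> Q x \<bullet> x" and \<nu>: "0 < \<nu>"
    and bound: "\<forall>z \<in> orthogonal_comp (kernel Q). \<nu> * norm z \<le> norm (Q z)"
    and grad: "\<And>z. GDERIV f z :> gradf z" and lip: "\<beta>-lipschitz_on UNIV gradf"
    and ran: "range gradf \<subseteq> range Q" and "\<beta> \<le> \<nu>"
  shows "f y \<le> f x + gradf x \<bullet> (y - x) + seminorm_sq Q (y - x) / 2"
proof -
  obtain w where w: "Q (y - x - Q w) = 0" "\<And>v. (y - x - Q w) \<bullet> Q v = 0"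
    using range_self_adjoint_decomposition[OF lin sa cl] by blast
  define p where "p = Q w"
  \<comment> \<open>The residual \<open>r\<close> is in the kernel of \<open>Q\<close> and
    orthogonal to all gradients: moving along it changes neither \<open>f\<close> nor the
    seminorm.\<close>
  define r where "r = y - x - p"
  have y: "y = x + p + r"
    by (simp add: r_def)
  have grad_r: "gradf z \<bullet> r = 0" for z
  proof -
    obtain v where "gradf z = Q v"
      using ran by blast
    then show ?thesis
      using w(2)[of v] by (simp add: r_def p_def inner_commute)
  qed
  have Qd: "Q (y - x) = Q p"
    using w(1) linear_diff[OF lin, of "y - x" p] by (simp add: p_def)
  have "Q p \<bullet> r = 0"
    using w(2)[of p] by (simp add: r_def p_def inner_commute)
  then have semi: "seminorm_sq Q (y - x) = Q p \<bullet> p"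
    unfolding seminorm_sq_def Qd by (simp add: y inner_add_right)
  have "f y = f (x + p)"
    unfolding y by (rule constant_along_gradient_orthogonal[OF grad grad_r])
  also have "\<dots> \<le> f x + gradf x \<bullet> p + \<beta> / 2 * (norm p)\<^sup>2"
    by (rule descent_lemma[OF grad lip])
  also have "gradf x \<bullet> p = gradf x \<bullet> (y - x)"
    by (simp add: y inner_add_right grad_r)
  finally have "f y \<le> f x + gradf x \<bullet> (y - x) + \<beta> / 2 * (norm p)\<^sup>2" .
  moreover have "\<beta> * (norm p)\<^sup>2 \<le> \<nu> * (norm p)\<^sup>2"
    using \<open>\<beta> \<le> \<nu>\<close> by (intro mult_right_mono) auto
  moreover have "\<nu> * (norm p)\<^sup>2 \<le> Q p \<bullet> p"
    by (rule psd_coercive_on_range[OF lin sa cl psd \<nu> bound]) (simp add: p_def)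
  ultimately show ?thesis
    by (simp add: semi)
qed

section \<open>The iteration and its convergence rate\<close>

lemma subdiff_imp_finite:
  assumes "proper_fun h" "u \<in> subdiff h x"
  shows "h x < \<infinity>"
proof -
  obtain y where "h y < \<infinity>"
    using assms(1) by (auto simp: proper_fun_def eff_dom_def)
  moreover have "h x + ereal (u \<bullet> (y - x)) \<le> h y"
    using assms(2) by (simp add: subdiff_def)
  ultimately show ?thesis
    by (cases "h x") auto
qed

theorem proposition3p5:
  fixes f :: "'a::{real_inner, complete_space} \<Rightarrow> real"
    and gradf :: "'a \<Rightarrow> 'a"
    and g :: "'a \<Rightarrow> ereal"
    and F :: "'a \<Rightarrow> ereal"
    and Q :: "'a \<Rightarrow> 'a"
    and \<beta> \<nu> :: real
    and xstar :: 'a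
    and x :: "nat \<Rightarrow> 'a"
  assumes "proper_fun (\<lambda>z. ereal (f z))" "lsc (\<lambda>z. ereal (f z))" "convex_fun (\<lambda>z. ereal (f z))"
    and "proper_fun g" "lsc g" "convex_fun g"
    and "\<And>z. GDERIV f z :> gradf z"
    and "\<beta>-lipschitz_on UNIV gradf"
    and "eff_dom (\<lambda>z. ereal (f z)) \<inter> eff_dom g \<noteq> {}"
    and F_def: "F = (\<lambda>z. ereal (f z) + g z)"
    and "Argmin F \<noteq> {}"
    and "bounded_linear Q" "self_adjoint Q" "closed (range Q)" "degenerate Q"
    and "range gradf \<subseteq> range Q"
    and "range (\<lambda>z. Q z - gradf z) \<subseteq> (\<Union>z. {u + Q z |u. u \<in> subdiff g z})"
    and "0 < \<nu>"
    and "\<forall>z \<in> orthogonal_comp (kernel Q). \<nu> * norm z \<le> norm (Q z)"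
    and "xstar \<in> Argmin F"
    and "\<And>k. 0 \<in> {u + gradf (x k) + Q (x (Suc k) - x k) |u. u \<in> subdiff g (x (Suc k))}"
    and "\<beta> \<le> \<nu>"
  shows "(\<lambda>k. F (x k)) \<longlonglongrightarrow> F xstar \<and>
    (\<forall>k\<ge>1. F (x k) - F xstar \<le> ereal (1 / (2 * real k) * seminorm_sq Q (x 0 - xstar)))"
proof -
  note proper_g = assms(4)
  have lin: "linear Q" and sa: "self_adjoint Q" and psd: "\<And>z. 0 \<le> Q z \<bullet> z"
    using \<open>bounded_linear Q\<close> \<open>self_adjoint Q\<close> \<open>degenerate Q\<close>
    by (auto simp: bounded_linear.linear degenerate_def)
  have conv: "convex_on UNIV f"
    using assms(3) by (simp add: convex_fun_ereal_iff)
  \<comment> \<open>\<open>real_of_ereal\<close> sends infinity to 0, so \<open>G\<close> represents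
    \<open>g\<close> only where \<open>g\<close> is finite; hence the finiteness premises
    below.\<close>
  define G where "G z = real_of_ereal (g z)" for z
  have g_not_minf: "g z \<noteq> -\<infinity>" for z
    using proper_g by (simp add: proper_fun_def)
  have g_G: "g z = ereal (G z)" if "g z < \<infinity>" for z
    using that g_not_minf[of z] by (cases "g z") (auto simp: G_def)
  have F_eq: "F z = ereal (f z + G z)" if "g z < \<infinity>" for z
    by (simp add: F_def g_G[OF that])
  have min: "F xstar \<le> F z" for z
    using \<open>xstar \<in> Argmin F\<close> by (simp add: Argmin_def is_arg_min_linorder)
  have fin_star: "g xstar < \<infinity>"
  proof -
    obtain z where "g z < \<infinity>"
      using proper_g by (auto simp: proper_fun_def eff_dom_def)
    then show ?thesis
      using min[of z] by (cases "g xstar") (auto simp: F_eq F_def)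
  qed
  have sub: "- gradf (x k) - Q (x (Suc k) - x k) \<in> subdiff g (x (Suc k))" for k
  proof -
    obtain u where "u \<in> subdiff g (x (Suc k))" "0 = u + gradf (x k) + Q (x (Suc k) - x k)"
      using assms(21)[of k] by blast
    moreover from this(2) have "u = - gradf (x k) - Q (x (Suc k) - x k)"
      by (simp add: algebra_simps eq_neg_iff_add_eq_0)
    ultimately show ?thesis
      by simp
  qed
  \<comment> \<open>The start \<open>x 0\<close> may lie outside the domain of \<open>g\<close>;
    only later iterates carry a subgradient.\<close>
  have fin: "g (x (Suc k)) < \<infinity>" for k
    using subdiff_imp_finite[OF proper_g sub] .
  define \<Phi> where "\<Phi> z = f z + G z" for z
  define q where "q z = seminorm_sq Q z" for z
  have q_nonneg: "0 \<le> q z" for z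
    by (simp add: q_def seminorm_sq_def psd)
  \<comment> \<open>Sum of three inequalities: subgradient of \<open>g\<close> at the new iterate,
    tangent of \<open>f\<close> at the old one, and descent in the seminorm. \<open>g (x k)\<close>
    does not enter, so \<open>k = 0\<close> is allowed.\<close>
  have step: "\<Phi> (x (Suc k)) - \<Phi> y \<le> (q (x k - y) - q (x (Suc k) - y)) / 2"
    if "g y < \<infinity>" for y k
  proof -
    let ?d = "x (Suc k) - x k"
    define A where "A = gradf (x k) \<bullet> ?d"
    define B where "B = gradf (x k) \<bullet> (y - x k)"
    define C where "C = Q ?d \<bullet> (x (Suc k) - y)"
    have "g (x (Suc k)) + ereal ((- gradf (x k) - Q ?d) \<bullet> (y - x (Suc k))) \<le> g y"
      using sub[of k] by (simp add: subdiff_def)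
    then have "G (x (Suc k)) + (- gradf (x k) - Q ?d) \<bullet> (y - x (Suc k)) \<le> G y"
      by (simp add: g_G[OF that] g_G[OF fin])
    moreover have "(- gradf (x k) - Q ?d) \<bullet> (y - x (Suc k)) = A - B + C"
      by (simp add: A_def B_def C_def inner_diff_left inner_diff_right)
    ultimately have "G (x (Suc k)) + (A - B + C) \<le> G y"
      by simp
    moreover have "f (x k) + B \<le> f y"
      unfolding B_def by (rule convex_on_above_gradient[OF conv assms(7)])
    moreover have "f (x (Suc k)) \<le> f (x k) + A + q ?d / 2"
      unfolding A_def q_def
      by (rule descent_lemma_seminorm[OF lin sa \<open>closed (range Q)\<close> psd \<open>0 < \<nu>\<close> assms(19) assms(7)
            assms(8) assms(16) \<open>\<beta> \<le> \<nu>\<close>])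
    \<comment> \<open>Three-point (polarization) identity for the form of \<open>Q\<close>.\<close>
    moreover have "q ?d - 2 * C = q (x k - y) - q (x (Suc k) - y)"
    proof -
      have "Q a \<bullet> b = Q b \<bullet> a" for a b
        using sa by (simp add: self_adjoint_def inner_commute)
      from this[of y "x k"] this[of y "x (Suc k)"] this[of "x (Suc k)" "x k"] show ?thesis
        by (simp add: C_def q_def seminorm_sq_def linear_diff[OF lin] inner_diff_left
            inner_diff_right algebra_simps)
    qed
    ultimately show ?thesis
      unfolding \<Phi>_def by argo
  qed
  \<comment> \<open>Take \<open>y\<close> to be the current iterate; the index starts at 1 because
    \<open>g y\<close> must be finite.\<close>
  have mono: "\<Phi> (x (Suc (Suc k))) \<le> \<Phi> (x (Suc k))" for k
  proof -
    have "q 0 = 0"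
      by (simp add: q_def seminorm_sq_def)
    then show ?thesis
      using step[OF fin, of "Suc k" k] q_nonneg[of "x (Suc (Suc k)) - x (Suc k)"] by simp
  qed
  \<comment> \<open>Keeping the subtracted term \<open>q (x (Suc k) - xstar)\<close> lets the sum
    telescope in the induction; monotonicity replaces the earlier values by the latest one.\<close>
  have tele: "real (Suc k) * (\<Phi> (x (Suc k)) - \<Phi> xstar)
      \<le> (q (x 0 - xstar) - q (x (Suc k) - xstar)) / 2" for k
  proof (induction k)
    case 0
    then show ?case
      using step[OF fin_star, of 0] by simp
  next
    case (Suc k)
    have "real (Suc k) * \<Phi> (x (Suc (Suc k))) \<le> real (Suc k) * \<Phi> (x (Suc k))"
      using mono by (intro mult_left_mono) auto
    then show ?case
      using Suc step[OF fin_star, of "Suc k"] by (simp add: algebra_simps)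
  qed
  have rate: "\<Phi> (x k) - \<Phi> xstar \<le> 1 / (2 * real k) * q (x 0 - xstar)" if "1 \<le> k" for k
  proof -
    obtain j where j: "k = Suc j"
      using \<open>1 \<le> k\<close> by (cases k) auto
    have "real k * (\<Phi> (x k) - \<Phi> xstar) \<le> q (x 0 - xstar) / 2"
      unfolding j by (rule order_trans[OF tele]) (simp add: q_nonneg)
    then show ?thesis
      using \<open>1 \<le> k\<close> by (simp add: field_simps)
  qed
  \<comment> \<open>\<open>F (x 0)\<close> may be infinite whereas \<open>\<Phi>\<close> is always
    real; equality from index 1 on suffices for the limit.\<close>
  have F_x: "F (x k) = ereal (\<Phi> (x k))" if "1 \<le> k" for k
  proof -
    obtain j where "k = Suc j"
      using \<open>1 \<le> k\<close> by (cases k) auto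
    then show ?thesis
      using F_eq[OF fin] by (simp add: \<Phi>_def)
  qed
  have F_star: "F xstar = ereal (\<Phi> xstar)"
    by (simp add: F_eq[OF fin_star] \<Phi>_def)
  \<comment> \<open>Squeezed between the minimal value and the rate bound.\<close>
  have "(\<lambda>k. \<Phi> (x k)) \<longlonglongrightarrow> \<Phi> xstar"
  proof (rule tendsto_sandwich)
    show "\<forall>\<^sub>F k in sequentially. \<Phi> xstar \<le> \<Phi> (x k)"
      using eventually_ge_at_top[of 1] by eventually_elim (use min F_x F_star in \<open>metis ereal_less_eq(3)\<close>)
    show "\<forall>\<^sub>F k in sequentially. \<Phi> (x k) \<le> \<Phi> xstar + q (x 0 - xstar) / 2 * inverse (real k)"
      using eventually_ge_at_top[of 1]
    proof eventually_elim
      case (elim k)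
      then show ?case
        using rate[OF elim] by (simp add: field_simps)
    qed
    have "(\<lambda>k. \<Phi> xstar + q (x 0 - xstar) / 2 * inverse (real k))
        \<longlonglongrightarrow> \<Phi> xstar + q (x 0 - xstar) / 2 * 0"
      by (intro tendsto_intros lim_inverse_n)
    then show "(\<lambda>k. \<Phi> xstar + q (x 0 - xstar) / 2 * inverse (real k)) \<longlonglongrightarrow> \<Phi> xstar"
      by simp
  qed simp
  then have "(\<lambda>k. ereal (\<Phi> (x k))) \<longlonglongrightarrow> F xstar"
    by (simp add: F_star)
  moreover have "\<forall>\<^sub>F k in sequentially. ereal (\<Phi> (x k)) = F (x k)"
    using eventually_ge_at_top[of 1] by eventually_elim (simp add: F_x)
  ultimately have "(\<lambda>k. F (x k)) \<longlonglongrightarrow> F xstar"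
    by (rule Lim_transform_eventually)
  then show ?thesis
    using rate by (auto simp: F_x F_star q_def)
qed

end
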